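(* Let $X$ be a completely regular Hausdorff space with $|X|>1$. Then the zero-set intersection graph $\Gamma(C(X))$ is not complemented.
   Context: $C(X)$ is the ring of all continuous functions $X\to\mathbb{R}$ with pointwise operations. For $f\in C(X)$, $Z(f)=\{x\in X: f(x)=0\}$. $\Gamma(C(X))$ is the simple graph whose vertex set is the set of non-units of $C(X)$ (equivalently, the $f$ with $Z(f)\neq\emptyset$), two distinct vertices $f,g$ being adjacent iff $Z(f)\cap Z(g)\neq\emptyset$. Two distinct vertices $u,v$ are orthogonal, written $u\perp v$, if they are adjacent and there is no vertex adjacent to both. A graph is complemented if for every vertex $u$ there is a vertex $v$ with $u\perp v$. *)

theory Defs
  imports "HOL-Analysis.Analysis" "HOL-Algebra.Ring" "Graph_Theory.Pair_Digraph"
begin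

text \<open>
  The ring of continuous real-valued functions on a space \<open>X\<close>.  Its elements are taken to be
  extensional (\<open>undefined\<close> outside \<open>topspace X\<close>), so that HOL equality on the carrier is equality
  of functions on \<open>topspace X\<close>.
\<close>

definition cfun_ring :: "'a topology \<Rightarrow> ('a \<Rightarrow> real) ring" where
  "cfun_ring X =
     \<lparr> carrier = {f \<in> extensional (topspace X). continuous_map X euclideanreal f},
       mult = (\<lambda>f g. \<lambda>x\<in>topspace X. f x * g x),
       one = (\<lambda>x\<in>topspace X. 1),
       zero = (\<lambda>x\<in>topspace X. 0),
       add = (\<lambda>f g. \<lambda>x\<in>topspace X. f x + g x) \<rparr>"

definition zero_set :: "'a topology \<Rightarrow> ('a \<Rightarrow> real) \<Rightarrow> 'a set" where
  "zero_set X f = {x \<in> topspace X. f x = 0}"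

text \<open>
  A simple graph, possibly infinite, is a \<^locale>\<open>pair_bidirected_digraph\<close>: a vertex set with a
  symmetric, loop-free set of arcs between vertices.
\<close>

definition zero_set_graph :: "'a topology \<Rightarrow> ('a \<Rightarrow> real) pair_pre_digraph" where
  "zero_set_graph X =
     (let V = carrier (cfun_ring X) - Units (cfun_ring X)
      in \<lparr> pverts = V,
           parcs = {(f, g). f \<in> V \<and> g \<in> V \<and> f \<noteq> g \<and> zero_set X f \<inter> zero_set X g \<noteq> {}} \<rparr>)"

definition vertex_orthogonal :: "'v pair_pre_digraph \<Rightarrow> 'v \<Rightarrow> 'v \<Rightarrow> bool" where
  "vertex_orthogonal G u v \<longleftrightarrow>
     u \<in> pverts G \<and> v \<in> pverts G \<and> u \<noteq> v \<and> (u, v) \<in> parcs G \<and>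
     \<not> (\<exists>w \<in> pverts G. (w, u) \<in> parcs G \<and> (w, v) \<in> parcs G)"

definition complemented_graph :: "'v pair_pre_digraph \<Rightarrow> bool" where
  "complemented_graph G \<longleftrightarrow> (\<forall>u \<in> pverts G. \<exists>v \<in> pverts G. vertex_orthogonal G u v)"

lemma continuous_map_restrict_topspace [simp]:
  "continuous_map X Y (\<lambda>x\<in>topspace X. f x) \<longleftrightarrow> continuous_map X Y f"
  by (auto elim: continuous_map_eq)

lemma cring_cfun_ring: "cring (cfun_ring X)"
proof (intro cringI abelian_groupI comm_monoidI)
  fix f assume f: "f \<in> carrier (cfun_ring X)"
  show "\<exists>g\<in>carrier (cfun_ring X). g \<oplus>\<^bsub>cfun_ring X\<^esub> f = \<zero>\<^bsub>cfun_ring X\<^esub>"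
    using f by (intro bexI[of _ "\<lambda>x\<in>topspace X. - f x"])
      (auto simp: cfun_ring_def intro!: continuous_map_minus)
qed (auto simp: cfun_ring_def fun_eq_iff extensional_def algebra_simps
       intro!: continuous_map_add continuous_map_real_mult)

lemma Units_cfun_ring:
  "Units (cfun_ring X) = {f \<in> carrier (cfun_ring X). zero_set X f = {}}"
proof (intro equalityI subsetI)
  fix f assume "f \<in> Units (cfun_ring X)"
  then obtain g where f: "f \<in> carrier (cfun_ring X)"
    and g: "(\<lambda>x\<in>topspace X. g x * f x) = (\<lambda>x\<in>topspace X. 1)"
    by (auto simp: Units_def cfun_ring_def)
  have "f x \<noteq> 0" if "x \<in> topspace X" for x
    using fun_cong[OF g, of x] that by auto
  with f show "f \<in> {f \<in> carrier (cfun_ring X). zero_set X f = {}}"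
    by (auto simp: zero_set_def)
next
  fix f assume "f \<in> {f \<in> carrier (cfun_ring X). zero_set X f = {}}"
  then have f: "f \<in> extensional (topspace X)" "continuous_map X euclideanreal f"
    and nz: "\<And>x. x \<in> topspace X \<Longrightarrow> f x \<noteq> 0"
    by (auto simp: cfun_ring_def zero_set_def)
  have "continuous_map X euclideanreal (\<lambda>x. inverse (f x))"
    using f nz by (intro continuous_map_real_inverse) auto
  then show "f \<in> Units (cfun_ring X)"
    using f nz unfolding Units_def
    by (auto simp: cfun_ring_def fun_eq_iff
        intro!: bexI[of _ "\<lambda>x\<in>topspace X. inverse (f x)"])
qed

lemma pair_bidirected_digraph_zero_set_graph: "pair_bidirected_digraph (zero_set_graph X)"
  by unfold_locales
    (auto simp: zero_set_graph_def Let_def symmetric_def sym_def)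

end

(* If u and v are distinct vertices with a common zero, then their midpoint (u + v) / 2 is a
   third function vanishing there, hence a common neighbour.  So no two vertices are orthogonal,
   while the zero function is always a vertex. *)
theory Submission
  imports Defs
begin

text \<open>Units are the nowhere vanishing functions by \<open>Units_cfun_ring\<close>; this lets
  vertices be recognised by a zero instead of by a missing inverse.\<close>

lemma pverts_zero_set_graph:
  "pverts (zero_set_graph X) = {f \<in> carrier (cfun_ring X). zero_set X f \<noteq> {}}"
  by (auto simp: zero_set_graph_def Let_def Units_cfun_ring)

lemma parcs_zero_set_graph:
  "parcs (zero_set_graph X) =
     {(f, g). f \<in> pverts (zero_set_graph X) \<and> g \<in> pverts (zero_set_graph X) \<and> f \<noteq> g \<and>
        zero_set X f \<inter> zero_set X g \<noteq> {}}"
  by (simp add: zero_set_graph_def Let_def)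

lemma not_vertex_orthogonal_zero_set_graph:
  "\<not> vertex_orthogonal (zero_set_graph X) u v"
proof
  assume orth: "vertex_orthogonal (zero_set_graph X) u v"
  then have V: "u \<in> pverts (zero_set_graph X)" "v \<in> pverts (zero_set_graph X)"
    and "u \<noteq> v"
    and no_common: "\<And>w. (w, u) \<in> parcs (zero_set_graph X) \<Longrightarrow> (w, v) \<notin> parcs (zero_set_graph X)"
    and "zero_set X u \<inter> zero_set X v \<noteq> {}"
    by (auto simp: vertex_orthogonal_def parcs_zero_set_graph)
  then obtain x where x: "x \<in> zero_set X u" "x \<in> zero_set X v" by blast
  from V have C: "u \<in> extensional (topspace X)" "continuous_map X euclideanreal u"
    "v \<in> extensional (topspace X)" "continuous_map X euclideanreal v"
    by (auto simp: pverts_zero_set_graph cfun_ring_def)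
  \<comment> \<open>Both functions are \<open>undefined\<close> off \<open>topspace X\<close>, so
    they must differ at a point of the space itself.\<close>
  from C(1,3) \<open>u \<noteq> v\<close> obtain y where y: "y \<in> topspace X" "u y \<noteq> v y"
    by (meson extensionalityI)
  \<comment> \<open>The restriction keeps the midpoint extensional, as membership in the carrier
    demands.\<close>
  define w where "w = (\<lambda>z\<in>topspace X. (u z + v z) / 2)"
  have "continuous_map X euclideanreal (\<lambda>z. (u z + v z) / 2)"
    using C by (intro continuous_map_real_divide continuous_map_add) auto
  then have "w \<in> carrier (cfun_ring X)"
    by (simp add: w_def cfun_ring_def)
  \<comment> \<open>This one zero makes \<open>w\<close> a non-unit and also supplies both
    intersections needed for adjacency.\<close>
  moreover have "x \<in> zero_set X w"
    using x by (simp add: w_def zero_set_def)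
  \<comment> \<open>At \<open>y\<close> the midpoint of two distinct reals equals neither of
    them.\<close>
  moreover have "w \<noteq> u" "w \<noteq> v"
    using y by (auto simp: w_def dest!: fun_cong[of _ _ y])
  ultimately show False
    using no_common[of w] V x by (auto simp: parcs_zero_set_graph pverts_zero_set_graph)
qed

theorem theorem3p5:
  fixes X :: "'a topology"
  assumes "completely_regular_space X" and "Hausdorff_space X"
    and "\<exists>x \<in> topspace X. \<exists>y \<in> topspace X. x \<noteq> y"
  shows "\<not> complemented_graph (zero_set_graph X)"
proof -
  \<comment> \<open>A point of \<open>X\<close> is a zero of this function. With a vertex at hand,
    being complemented cannot hold vacuously.\<close>
  have "(\<lambda>x\<in>topspace X. 0) \<in> pverts (zero_set_graph X)"
    using assms(3) by (auto simp: pverts_zero_set_graph cfun_ring_def zero_set_def)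
  then show ?thesis
    using not_vertex_orthogonal_zero_set_graph by (auto simp: complemented_graph_def)
qed

end
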